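(* Let $\tau>0$. (i) Let $B_c\in\mathcal B(\mathcal H)$ be such that $M_\tau(-B_c)$ is well defined in $\mathcal B(\mathcal H)$. If the zero solution of $\dot x=-B_cx$ is exponentially stable and $B_c$ has hypocoercivity index $m\in\mathbb N_0$, then the zero solution of $x_{k+1}=B_dx_k$ with $B_d:=M_\tau(-B_c)$ is exponentially stable and $B_d$ has hypocontractivity index $m$. (ii) Let $B_d\in\mathcal B(\mathcal H)$ be such that $M_\tau^{-1}(B_d)$ is well defined in $\mathcal B(\mathcal H)$. If the zero solution of $x_{k+1}=B_dx_k$ is exponentially stable and $B_d$ has hypocontractivity index $m\in\mathbb N_0$, then the zero solution of $\dot x=-B_cx$ with $-B_c:=M_\tau^{-1}(B_d)$ is exponentially stable and $B_c$ has hypocoercivity index $m$.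
   Context: $\mathcal H$ is a separable complex Hilbert space, $\mathcal B(\mathcal H)$ the bounded linear operators on it, $\Lambda(A)$ the spectrum of $A$. The scaled Cayley transform is $M_\tau(z)=\frac{1+\frac\tau2z}{1-\frac\tau2z}$, with inverse $M_\tau^{-1}(z)=\frac{2(z-1)}{\tau(z+1)}$. For operators, $M_\tau(-B_c)=(I-\frac\tau2B_c)(I+\frac\tau2B_c)^{-1}$ is well defined if $\frac2\tau\notin\Lambda(-B_c)$, and $M_\tau^{-1}(B_d)=\frac2\tau(B_d-I)(B_d+I)^{-1}$ is well defined if $-1\notin\Lambda(B_d)$. The zero solution of $\dot x=-B_cx$ is exponentially stable if there are $C\ge1,\lambda>0$ with $\|e^{-B_ct}x^0\|\le Ce^{-\lambda t}\|x^0\|$ for all $x^0\in\mathcal H$, $t\ge0$. The zero solution of $x_{k+1}=B_dx_k$ is exponentially stable if there are $C\ge1$, $0<\lambda<1$ with $\|B_d^kx^0\|\le C\lambda^k\|x^0\|$ for all $x^0\in\mathcal H$, $k\in\mathbb N_0$. Hypocoercivity index: defined for $B_c$ with $B_H:=\frac{B_c+B_c^*}2\ge0$ (i.e. $-B_c$ semi-dissipative) as the smallest $m\in\mathbb N_0$ (if it exists) such that $\sum_{j=0}^m(B_c^* )^jB_HB_c^j\ge\kappa I$ for some $\kappa>0$; "$B_c$ has hypocoercivity index $m$" includes $B_H\ge0$. Hypocontractivity index: defined for $B_d$ with $\|B_d\|\le1$ (semi-contractive) as the smallest $m\in\mathbb N_0$ (if it exists) such that $\sum_{j=0}^m(B_d^*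 )^j(I-B_d^*B_d)B_d^j\ge\kappa I$ for some $\kappa>0$; "$B_d$ has hypocontractivity index $m$" includes $\|B_d\|\le1$. *)

theory Defs
  imports "HOL-Analysis.Analysis"
begin

(* A complex Hilbert space: a complete real inner product space carrying a complex scalar
   multiplication that extends the real one and a sesquilinear, conjugate symmetric form whose
   real part is the given real inner product. In particular, norm x ^ 2 = cinner x x.
   The form is linear in its first argument. *)
class complex_hilbert_space = banach + real_inner +
  fixes scaleC :: "complex \<Rightarrow> 'a \<Rightarrow> 'a"  (infixr "*\<^sub>C" 75)
    and cinner :: "'a \<Rightarrow> 'a \<Rightarrow> complex"
  assumes scaleC_add_right: "c *\<^sub>C (x + y) = c *\<^sub>C x + c *\<^sub>C y"
    and scaleC_add_left: "(c + d) *\<^sub>C x = c *\<^sub>C x + d *\<^sub>C x"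
    and scaleC_scaleC: "c *\<^sub>C d *\<^sub>C x = (c * d) *\<^sub>C x"
    and scaleC_of_real: "complex_of_real r *\<^sub>C x = r *\<^sub>R x"
    and cinner_commute: "cinner x y = cnj (cinner y x)"
    and cinner_add_left: "cinner (x + y) z = cinner x z + cinner y z"
    and cinner_scaleC_left: "cinner (c *\<^sub>C x) y = c * cinner x y"
    and Re_cinner: "Re (cinner x y) = inner x y"

instantiation complex :: complex_hilbert_space
begin
definition scaleC_complex :: "complex \<Rightarrow> complex \<Rightarrow> complex"
  where "scaleC_complex c x = c * x"
definition cinner_complex :: "complex \<Rightarrow> complex \<Rightarrow> complex"
  where "cinner_complex x y = x * cnj y"
instance
  by standard (auto simp: scaleC_complex_def cinner_complex_def algebra_simps
      scaleR_conv_of_real inner_complex_def)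
end

lemma cinner_self: "cinner x x = complex_of_real ((norm x)\<^sup>2)"
  for x :: "'a::complex_hilbert_space"
proof -
  have "Im (cinner x x) = 0"
    using cinner_commute[of x x] by (metis complex_cnj_cancel_iff cnj.simps(2) equal_neg_zero)
  then show ?thesis
    by (simp add: complex_eq_iff Re_cinner power2_norm_eq_inner)
qed

lemma norm_scaleC: "norm (c *\<^sub>C x) = cmod c * norm x"
  for x :: "'a::complex_hilbert_space"
proof -
  have "cinner (c *\<^sub>C x) (c *\<^sub>C x) = c * cnj c * cinner x x"
    by (metis cinner_commute cinner_scaleC_left complex_cnj_mult mult.assoc)
  then have "complex_of_real ((norm (c *\<^sub>C x))\<^sup>2) = complex_of_real ((cmod c * norm x)\<^sup>2)"
    by (simp only: cinner_self complex_norm_square[symmetric] power_mult_distrib of_real_mult of_real_power)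
  then have "(norm (c *\<^sub>C x))\<^sup>2 = (cmod c * norm x)\<^sup>2"
    by (simp only: of_real_eq_iff)
  then show ?thesis
    by (simp add: power2_eq_iff_nonneg)
qed

lemma bounded_linear_scaleC: "bounded_linear (\<lambda>x::'a::complex_hilbert_space. c *\<^sub>C x)"
proof (rule bounded_linear_intro[where K = "cmod c"])
  fix r :: real and x :: 'a
  show "c *\<^sub>C (r *\<^sub>R x) = r *\<^sub>R (c *\<^sub>C x)"
    by (simp only: scaleC_of_real[symmetric] scaleC_scaleC mult.commute)
qed (simp_all add: scaleC_add_right norm_scaleC mult.commute)

(* Bounded operators on H are represented by the real-linear bounded functions of the type
   'a \<Rightarrow>\<^sub>L 'a satisfying the following predicate; the operator norm is the same. *)
definition complex_linear :: "('a::complex_hilbert_space \<Rightarrow>\<^sub>L 'a) \<Rightarrow> bool"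
  where "complex_linear A \<longleftrightarrow> (\<forall>c x. blinfun_apply A (c *\<^sub>C x) = c *\<^sub>C blinfun_apply A x)"

definition scalar_op :: "complex \<Rightarrow> ('a::complex_hilbert_space \<Rightarrow>\<^sub>L 'a)"
  where "scalar_op c = Blinfun (\<lambda>x. c *\<^sub>C x)"

primrec op_power :: "('a::real_normed_vector \<Rightarrow>\<^sub>L 'a) \<Rightarrow> nat \<Rightarrow> ('a \<Rightarrow>\<^sub>L 'a)"
  where
    "op_power A 0 = id_blinfun"
  | "op_power A (Suc n) = A o\<^sub>L op_power A n"

definition op_exp :: "('a::banach \<Rightarrow>\<^sub>L 'a) \<Rightarrow> ('a \<Rightarrow>\<^sub>L 'a)"
  where "op_exp A = (\<Sum>n. (1 / fact n) *\<^sub>R op_power A n)"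

(* For complex-linear A the adjoint exists by the Riesz representation theorem; it is unique
   and complex-linear. *)
definition op_adjoint :: "('a::complex_hilbert_space \<Rightarrow>\<^sub>L 'a) \<Rightarrow> ('a \<Rightarrow>\<^sub>L 'a)"
  where "op_adjoint A =
    (THE B. \<forall>x y. cinner (blinfun_apply A x) y = cinner x (blinfun_apply B y))"

definition is_op_inverse ::
    "('a::complex_hilbert_space \<Rightarrow>\<^sub>L 'a) \<Rightarrow> ('a \<Rightarrow>\<^sub>L 'a) \<Rightarrow> bool"
  where "is_op_inverse A B \<longleftrightarrow>
    complex_linear B \<and> A o\<^sub>L B = id_blinfun \<and> B o\<^sub>L A = id_blinfun"

definition op_inverse :: "('a::complex_hilbert_space \<Rightarrow>\<^sub>L 'a) \<Rightarrow> ('a \<Rightarrow>\<^sub>L 'a)"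
  where "op_inverse A = (THE B. is_op_inverse A B)"

definition op_spectrum :: "('a::complex_hilbert_space \<Rightarrow>\<^sub>L 'a) \<Rightarrow> complex set"
  where "op_spectrum A = {c. \<nexists>B. is_op_inverse (A - scalar_op c) B}"

(* The partial order of bounded operators: B - A is positive semidefinite. *)
definition op_le :: "('a::complex_hilbert_space \<Rightarrow>\<^sub>L 'a) \<Rightarrow> ('a \<Rightarrow>\<^sub>L 'a) \<Rightarrow> bool"
  where "op_le A B \<longleftrightarrow> (\<forall>x. cinner (blinfun_apply (B - A) x) x \<in> \<real>\<^sub>\<ge>\<^sub>0)"

definition hermitian_part :: "('a::complex_hilbert_space \<Rightarrow>\<^sub>L 'a) \<Rightarrow> ('a \<Rightarrow>\<^sub>L 'a)"
  where "hermitian_part B = (1/2) *\<^sub>R (B + op_adjoint B)"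

definition hypocoercive_upto :: "('a::complex_hilbert_space \<Rightarrow>\<^sub>L 'a) \<Rightarrow> nat \<Rightarrow> bool"
  where "hypocoercive_upto B m \<longleftrightarrow>
    (\<exists>\<kappa>>0. op_le (\<kappa> *\<^sub>R id_blinfun)
      (\<Sum>j=0..m. op_power (op_adjoint B) j o\<^sub>L hermitian_part B o\<^sub>L op_power B j))"

definition has_hypocoercivity_index :: "('a::complex_hilbert_space \<Rightarrow>\<^sub>L 'a) \<Rightarrow> nat \<Rightarrow> bool"
  where "has_hypocoercivity_index B m \<longleftrightarrow>
    op_le 0 (hermitian_part B) \<and> hypocoercive_upto B m \<and> (\<forall>k<m. \<not> hypocoercive_upto B k)"

definition hypocontractive_upto :: "('a::complex_hilbert_space \<Rightarrow>\<^sub>L 'a) \<Rightarrow> nat \<Rightarrow> bool"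
  where "hypocontractive_upto B m \<longleftrightarrow>
    (\<exists>\<kappa>>0. op_le (\<kappa> *\<^sub>R id_blinfun)
      (\<Sum>j=0..m. op_power (op_adjoint B) j o\<^sub>L (id_blinfun - (op_adjoint B o\<^sub>L B)) o\<^sub>L op_power B j))"

definition has_hypocontractivity_index :: "('a::complex_hilbert_space \<Rightarrow>\<^sub>L 'a) \<Rightarrow> nat \<Rightarrow> bool"
  where "has_hypocontractivity_index B m \<longleftrightarrow>
    norm B \<le> 1 \<and> hypocontractive_upto B m \<and> (\<forall>k<m. \<not> hypocontractive_upto B k)"

(* Exponential stability of the zero solution of x' = A x. *)
definition exp_stable_continuous :: "('a::banach \<Rightarrow>\<^sub>L 'a) \<Rightarrow> bool"
  where "exp_stable_continuous A \<longleftrightarrow>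
    (\<exists>C\<ge>1. \<exists>\<omega>>0. \<forall>x. \<forall>t\<ge>0.
      norm (blinfun_apply (op_exp (t *\<^sub>R A)) x) \<le> C * exp (- \<omega> * t) * norm x)"

(* Exponential stability of the zero solution of x (k+1) = A (x k). *)
definition exp_stable_discrete :: "('a::real_normed_vector \<Rightarrow>\<^sub>L 'a) \<Rightarrow> bool"
  where "exp_stable_discrete A \<longleftrightarrow>
    (\<exists>C\<ge>1. \<exists>q::real. 0 < q \<and> q < 1 \<and>
      (\<forall>x k. norm (blinfun_apply (op_power A k) x) \<le> C * q ^ k * norm x))"

(* The operator versions of the map M(z) = (1 + tau/2 z) / (1 - tau/2 z) and of its inverse
   2 (z - 1) / (tau (z + 1)); meaningful if 2/tau, respectively -1, is not in the spectrum. *)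
definition cayley :: "real \<Rightarrow> ('a::complex_hilbert_space \<Rightarrow>\<^sub>L 'a) \<Rightarrow> ('a \<Rightarrow>\<^sub>L 'a)"
  where "cayley \<tau> A =
    (id_blinfun + (\<tau> / 2) *\<^sub>R A) o\<^sub>L op_inverse (id_blinfun - (\<tau> / 2) *\<^sub>R A)"

definition inv_cayley :: "real \<Rightarrow> ('a::complex_hilbert_space \<Rightarrow>\<^sub>L 'a) \<Rightarrow> ('a \<Rightarrow>\<^sub>L 'a)"
  where "inv_cayley \<tau> A =
    (2 / \<tau>) *\<^sub>R ((A - id_blinfun) o\<^sub>L op_inverse (A + id_blinfun))"

end

theory Submission
  imports Defs
begin

text \<open>
  Put \<open>h = \<tau> / 2\<close>, \<open>T = I + h B\<close> and \<open>U = I - h B\<close> for the generator \<open>B\<close>. Its Cayley transform is the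
  operator \<open>D\<close> with \<open>D T = U\<close>, and both parts of the theorem concern such a pair, once the
  inverses are known to exist (locale \<open>cayley_pair\<close>). The two operators are linked by the energy identity
  \<open>(norm (T x))\<^sup>2 - (norm (D (T x)))\<^sup>2 = 4 * h * \<phi> x\<close> with \<open>\<phi> x = inner (B x) x\<close>. Since \<open>T\<close> is
  surjective, \<open>D\<close> is a contraction iff \<open>\<phi>\<close> is nonnegative.

  For the indices, move the adjoints to the other side of the inner product. Hypocoercivity up to order
  \<open>m\<close> then says that \<open>\<Sum>j\<le>m. \<phi> (B\<^sup>j x)\<close> dominates the squared norm, and hypocontractivity up to order \<open>m\<close>,
  by the energy identity at \<open>D\<^sup>j x\<close>, that \<open>\<Sum>j\<le>m. \<phi> (D\<^sup>j x)\<close> does. Substituting \<open>x = T\<^sup>m z\<close> turns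
  \<open>D\<^sup>j x\<close> into \<open>U\<^sup>j T\<^bsup>m - j\<^esup> z\<close>. The polynomials \<open>(1 - h s)\<^sup>j (1 + h s)\<^bsup>m - j\<^esup>\<close> span the same space
  as \<open>1, s, \<dots>, s\<^sup>m\<close>, and a nonnegative quadratic form is controlled along linear combinations, so the two
  conditions are equivalent for every \<open>m\<close> (\<open>coercive_forms_iff\<close>). Equality of the least such \<open>m\<close> follows.

  Stability of \<open>D\<close> comes from hypocontractivity itself, because the sum that defines it telescopes and makes
  \<open>D\<^bsup>m + 1\<^esup>\<close> a strict contraction (\<open>hypocontractive_imp_exp_stable_discrete\<close>). Stability of
  the flow generated by \<open>- B\<close> comes from that of \<open>D\<close>: a finite sum of squares \<open>\<Sum>k<n. (norm (D\<^sup>k x))\<^sup>2\<close> that is a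
  Lyapunov function for \<open>D\<close> is also one for the flow (\<open>exp_stable_continuous_if_discrete\<close>).
\<close>

section \<open>Powers and exponentials of operators\<close>

lemma op_power_funpow: "blinfun_apply (op_power A n) = blinfun_apply A ^^ n"
  by (induction n) auto

lemma op_power_id: "op_power id_blinfun n = id_blinfun"
  by (induction n) (auto intro: blinfun_eqI)

lemma op_power_Suc_right: "op_power A (Suc n) = op_power A n o\<^sub>L A"
  by (rule blinfun_eqI) (simp add: op_power_funpow funpow_swap1)

lemma op_power_commute:
  assumes "X o\<^sub>L Y = Y o\<^sub>L X"
  shows "X o\<^sub>L op_power Y n = op_power Y n o\<^sub>L X"
proof (induction n)
  case (Suc n)
  have "X (Y (op_power Y n z)) = Y (op_power Y n (X z))" for z
    using arg_cong[OF assms, of "\<lambda>F. F (op_power Y n z)"] arg_cong[OF Suc, of "\<lambda>F. F z"] by simp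
  then show ?case by (intro blinfun_eqI) simp
qed (auto intro: blinfun_eqI)

lemma op_power_mult_commuting:
  assumes "X o\<^sub>L Y = Y o\<^sub>L X"
  shows "op_power (X o\<^sub>L Y) n = op_power X n o\<^sub>L op_power Y n"
proof (induction n)
  case (Suc n)
  have "Y (op_power X n z) = op_power X n (Y z)" for z
    using arg_cong[OF op_power_commute[OF assms[symmetric], of n], of "\<lambda>F. F z"] by simp
  with Suc show ?case by (intro blinfun_eqI) simp
qed (auto intro: blinfun_eqI)

lemma op_power_scaleR: "op_power (t *\<^sub>R A) n = t ^ n *\<^sub>R op_power A n"
  by (induction n) (auto intro!: blinfun_eqI simp: blinfun.bilinear_simps)

lemma norm_op_power_le: "norm (op_power A n) \<le> norm A ^ n"
proof (induction n)
  case (Suc n)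
  have "norm (op_power A (Suc n)) \<le> norm A * norm (op_power A n)"
    by (simp add: norm_blinfun_compose)
  also have "\<dots> \<le> norm A * norm A ^ n" by (intro mult_left_mono Suc) simp
  finally show ?case by simp
qed (simp add: norm_blinfun_id_le)

lemma op_exp_0: "op_exp 0 = id_blinfun"
proof -
  have "op_exp 0 = (\<Sum>n. if n = 0 then id_blinfun else 0)"
    unfolding op_exp_def
  proof (intro arg_cong[where f = suminf] ext)
    fix n show "(1 / fact n) *\<^sub>R op_power 0 n = (if n = 0 then id_blinfun else 0)"
      by (cases n) auto
  qed
  also have "\<dots> = id_blinfun"
    using suminf_finite[of "{0::nat}" "\<lambda>n. if n = 0 then id_blinfun else 0"] by simp
  finally show ?thesis .
qed

text \<open>The exponential series is differentiated termwise on a ball of radius \<open>r\<close> around \<open>0\<close>, where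
  \<open>(r * norm A) ^ n / fact n\<close> majorizes its terms.\<close>

lemma op_exp_has_vector_derivative:
  fixes A :: "'a::banach \<Rightarrow>\<^sub>L 'a"
  shows "((\<lambda>t. op_exp (t *\<^sub>R A)) has_vector_derivative (A o\<^sub>L op_exp (t *\<^sub>R A))) (at t)"
proof -
  define F where "F n s = (s ^ n / fact n) *\<^sub>R op_power A n" for n and s :: real
  define F' where "F' n s k = k *\<^sub>R ((real n * s ^ (n - 1) / fact n) *\<^sub>R op_power A n)"
    for n and s k :: real
  define r where "r = \<bar>t\<bar> + 1"
  define S where "S = ball (0::real) r"
  have exp_F: "op_exp (s *\<^sub>R A) = (\<Sum>n. F n s)" for s
    by (simp add: op_exp_def F_def op_power_scaleR)
  have F_le: "norm (F n s) \<le> (r * norm A) ^ n / fact n" if "s \<in> S" for n s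
  proof -
    have "\<bar>s\<bar> ^ n * norm (op_power A n) \<le> r ^ n * norm A ^ n"
      using that by (intro mult_mono power_mono norm_op_power_le) (auto simp: S_def r_def)
    then show ?thesis
      by (simp add: F_def power_abs power_mult_distrib divide_right_mono)
  qed
  have summable_bound: "summable (\<lambda>n. (r * norm A) ^ n / fact n)"
    using summable_exp[of "r * norm A"] by (simp add: divide_inverse mult.commute)
  have unif: "uniform_limit S (\<lambda>n s. \<Sum>i<n. F i s) (\<lambda>s. op_exp (s *\<^sub>R A)) sequentially"
    unfolding exp_F by (rule Weierstrass_m_test[OF F_le summable_bound])
  have F_sums: "(\<lambda>n. F n s) sums op_exp (s *\<^sub>R A)" if "s \<in> S" for s
    using tendsto_uniform_limitI[OF unif that] by (simp add: sums_def)
  have F'_Suc: "F' (Suc n) s k = k *\<^sub>R (A o\<^sub>L F n s)" for n s k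
    by (simp add: F'_def F_def bounded_bilinear.scaleR_right[OF bounded_bilinear_blinfun_compose] del: of_nat_Suc)
  \<comment> \<open>The derivative of the term of degree \<open>Suc n\<close> is \<open>A\<close> applied to the term of degree \<open>n\<close>, so the
    derivatives converge uniformly because the series itself does.\<close>
  have partial: "(\<Sum>i<Suc n. F' i s k) = k *\<^sub>R (A o\<^sub>L (\<Sum>i<n. F i s))" for n s k
    unfolding sum.lessThan_Suc_shift F'_Suc
    by (simp add: F'_def scaleR_sum_right bounded_bilinear.sum_right[OF bounded_bilinear_blinfun_compose])
  have "\<exists>g. \<forall>s\<in>S. (\<lambda>n. F n s) sums g s \<and>
      (g has_derivative (\<lambda>k. k *\<^sub>R (A o\<^sub>L op_exp (s *\<^sub>R A)))) (at s within S)"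
  proof (rule has_derivative_series)
    show "convex S" "t \<in> S" by (auto simp: S_def r_def)
    then show "(\<lambda>n. F n t) sums op_exp (t *\<^sub>R A)" by (intro F_sums)
    show "(F n has_derivative F' n s) (at s within S)" if "s \<in> S" for n s
      unfolding F_def F'_def
      by (auto intro!: derivative_eq_intros simp: field_simps)
    fix e :: real assume e: "e > 0"
    then have "e / (norm A + 1) > 0" by (simp add: add_nonneg_pos)
    then obtain N where N: "\<And>n s. n \<ge> N \<Longrightarrow> s \<in> S \<Longrightarrow>
        dist (\<Sum>i<n. F i s) (op_exp (s *\<^sub>R A)) < e / (norm A + 1)"
      using unif unfolding uniform_limit_iff eventually_sequentially by blast
    have "norm ((\<Sum>i<n. F' i s k) - k *\<^sub>R (A o\<^sub>L op_exp (s *\<^sub>R A))) \<le> e * norm k"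
      if n: "n \<ge> Suc N" and s: "s \<in> S" for n s k
    proof -
      obtain n' where n': "n = Suc n'" "n' \<ge> N" using n by (cases n) auto
      let ?E = "(\<Sum>i<n'. F i s) - op_exp (s *\<^sub>R A)"
      have "norm (A o\<^sub>L ?E) \<le> norm A * (e / (norm A + 1))"
        using norm_blinfun_compose[of A ?E] N[OF n'(2) s]
        by (smt (verit) dist_norm mult_left_mono norm_ge_zero)
      also have "\<dots> \<le> e"
        using e add_nonneg_pos[OF norm_ge_zero zero_less_one, of A]
        by (simp add: pos_divide_le_eq algebra_simps)
      finally have "\<bar>k\<bar> * norm (A o\<^sub>L ?E) \<le> \<bar>k\<bar> * e" by (rule mult_left_mono) simp
      moreover have "(\<Sum>i<n. F' i s k) - k *\<^sub>R (A o\<^sub>L op_exp (s *\<^sub>R A)) = k *\<^sub>R (A o\<^sub>L ?E)"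
        unfolding n'(1) partial by (simp add: scaleR_diff_right bounded_bilinear.diff_right[OF bounded_bilinear_blinfun_compose])
      ultimately show ?thesis by (simp add: mult.commute)
    qed
    then show "\<forall>\<^sub>F n in sequentially. \<forall>s\<in>S. \<forall>k.
        norm ((\<Sum>i<n. F' i s k) - k *\<^sub>R (A o\<^sub>L op_exp (s *\<^sub>R A))) \<le> e * norm k"
      unfolding eventually_sequentially by blast
  qed
  then obtain g where g: "\<And>s. s \<in> S \<Longrightarrow> (\<lambda>n. F n s) sums g s"
    "\<And>s. s \<in> S \<Longrightarrow> (g has_derivative (\<lambda>k. k *\<^sub>R (A o\<^sub>L op_exp (s *\<^sub>R A)))) (at s within S)"
    by blast
  have g_eq: "g s = op_exp (s *\<^sub>R A)" if "s \<in> S" for s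
    using g(1)[OF that] F_sums[OF that] sums_unique2 by blast
  have S: "open S" "t \<in> S" by (auto simp: S_def r_def)
  have "(g has_vector_derivative (A o\<^sub>L op_exp (t *\<^sub>R A))) (at t)"
    using g(2)[OF S(2)] at_within_open[OF S(2,1)] by (simp add: has_vector_derivative_def)
  then show ?thesis
    by (rule has_vector_derivative_transform_within_open[OF _ S g_eq])
qed

section \<open>Quadratic forms along operator polynomials\<close>

definition coercive_form :: "('a::real_normed_vector \<Rightarrow> real) \<Rightarrow> bool"
  where "coercive_form p \<longleftrightarrow> (\<exists>\<kappa>>0. \<forall>x. \<kappa> * (norm x)\<^sup>2 \<le> p x)"

text \<open>The factor \<open>C\<close> may be \<open>0\<close>, as happens on the zero space; hence the constant \<open>C + 1\<close> in the proof.\<close>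

lemma coercive_form_dominated:
  assumes "coercive_form p" "C \<ge> 0" "\<And>x. p x \<le> C * q x" "\<And>x. 0 \<le> q x"
  shows "coercive_form q"
proof -
  obtain \<kappa> where \<kappa>: "\<kappa> > 0" "\<And>x. \<kappa> * (norm x)\<^sup>2 \<le> p x"
    using assms(1) unfolding coercive_form_def by blast
  have "\<kappa> / (C + 1) * (norm x)\<^sup>2 \<le> q x" for x
  proof -
    have "\<kappa> * (norm x)\<^sup>2 \<le> (C + 1) * q x"
      using \<kappa>(2)[of x] assms(3,4)[of x] by (simp add: algebra_simps)
    then show ?thesis using assms(2) by (simp add: field_simps)
  qed
  moreover have "\<kappa> / (C + 1) > 0" using \<kappa>(1) assms(2) by simp
  ultimately show ?thesis unfolding coercive_form_def by blast
qed

lemma coercive_form_compose_left_invertible: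
  assumes "coercive_form p" "R o\<^sub>L T = id_blinfun"
  shows "coercive_form (\<lambda>x. p (blinfun_apply T x))"
proof -
  obtain \<kappa> where \<kappa>: "\<kappa> > 0" "\<And>x. \<kappa> * (norm x)\<^sup>2 \<le> p x"
    using assms(1) unfolding coercive_form_def by blast
  define c where "c = norm R + 1"
  have c: "c > 0" by (simp add: c_def add_nonneg_pos)
  have "\<kappa> / c\<^sup>2 * (norm x)\<^sup>2 \<le> p (T x)" for x
  proof -
    have "norm x = norm (R (T x))" using assms(2) by (metis blinfun_apply_blinfun_compose blinfun_apply_id_blinfun)
    also have "\<dots> \<le> norm R * norm (T x)" by (rule norm_blinfun)
    also have "\<dots> \<le> c * norm (T x)" by (intro mult_right_mono) (simp_all add: c_def)
    finally have "(norm x)\<^sup>2 \<le> c\<^sup>2 * (norm (T x))\<^sup>2"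
      by (metis norm_ge_zero power_mono power_mult_distrib)
    then have "\<kappa> / c\<^sup>2 * (norm x)\<^sup>2 \<le> \<kappa> * (norm (T x))\<^sup>2"
      using c \<kappa>(1) by (simp add: field_simps)
    then show ?thesis using \<kappa>(2)[of "T x"] by linarith
  qed
  moreover have "\<kappa> / c\<^sup>2 > 0" using \<kappa>(1) c by simp
  ultimately show ?thesis unfolding coercive_form_def by blast
qed

lemma coercive_form_compose_iff:
  assumes "R o\<^sub>L T = id_blinfun" "T o\<^sub>L R = id_blinfun"
  shows "coercive_form (\<lambda>x. p (blinfun_apply T x)) \<longleftrightarrow> coercive_form p"
proof
  assume "coercive_form (\<lambda>x. p (T x))"
  from coercive_form_compose_left_invertible[OF this assms(2)] assms(2)
  show "coercive_form p" by (metis (no_types, lifting) blinfun_apply_blinfun_compose blinfun_apply_id_blinfun ext)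
qed (rule coercive_form_compose_left_invertible[OF _ assms(1)])

text \<open>The homogeneous monomials of degree \<open>n\<close> in two commuting operators. With \<open>Y = id_blinfun\<close> they are
  the powers of \<open>X\<close> up to order \<open>n\<close>; homogeneity in two variables makes the
  substitutions of the Cayley transform linear.\<close>

definition monomials :: "('a::real_normed_vector \<Rightarrow>\<^sub>L 'a) \<Rightarrow> ('a \<Rightarrow>\<^sub>L 'a) \<Rightarrow> nat \<Rightarrow> ('a \<Rightarrow>\<^sub>L 'a) set"
  where "monomials X Y n = {op_power X i o\<^sub>L op_power Y l | i l. i + l = n}"

lemma linear_image_in_span:
  assumes "linear f" "\<And>w. w \<in> S \<Longrightarrow> f w \<in> span S'" "z \<in> span S"
  shows "f z \<in> span S'"
proof -
  have "f z \<in> span (f ` S)" using assms(1,3) linear_span_image by blast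
  also have "\<dots> \<subseteq> span S'" using assms(2) by (intro span_minimal subspace_span) auto
  finally show ?thesis .
qed

lemma linear_compose_left: "linear (\<lambda>Z. X o\<^sub>L Z)"
  by (intro bounded_linear.linear bounded_linear_intros)

lemma compose_in_span_monomials:
  assumes comm: "X o\<^sub>L Y = Y o\<^sub>L X" and Z: "Z \<in> span (monomials X Y n)"
  shows "X o\<^sub>L Z \<in> span (monomials X Y (Suc n))" "Y o\<^sub>L Z \<in> span (monomials X Y (Suc n))"
proof -
  have "X o\<^sub>L W \<in> span (monomials X Y (Suc n)) \<and> Y o\<^sub>L W \<in> span (monomials X Y (Suc n))"
    if W_in: "W \<in> monomials X Y n" for W
  proof -
    obtain i l where W: "W = op_power X i o\<^sub>L op_power Y l" "i + l = n"
      using W_in unfolding monomials_def by blast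
    have "X o\<^sub>L W = op_power X (Suc i) o\<^sub>L op_power Y l"
      unfolding W by (intro blinfun_eqI) simp
    moreover have "Y o\<^sub>L W = op_power X i o\<^sub>L op_power Y (Suc l)"
    proof (rule blinfun_eqI)
      show "(Y o\<^sub>L W) z = (op_power X i o\<^sub>L op_power Y (Suc l)) z" for z
        using arg_cong[OF op_power_commute[OF comm[symmetric], of i], of "\<lambda>F. F (op_power Y l z)"]
        unfolding W by simp
    qed
    ultimately show ?thesis
      unfolding monomials_def using W(2) by (metis (mono_tags, lifting) add_Suc add_Suc_right mem_Collect_eq span_base)
  qed
  then show "X o\<^sub>L Z \<in> span (monomials X Y (Suc n))" "Y o\<^sub>L Z \<in> span (monomials X Y (Suc n))"
    using linear_image_in_span[OF linear_compose_left _ Z] by blast+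
qed

text \<open>Under a linear substitution \<open>X', Y'\<close> of the variables, every monomial of degree \<open>n\<close> in \<open>X', Y'\<close> is
  a linear combination of monomials of the same degree in \<open>X, Y\<close>: each factor \<open>X'\<close> or \<open>Y'\<close> raises
  the degree of such a combination by one.\<close>

lemma monomials_change_of_variables:
  assumes comm: "X o\<^sub>L Y = Y o\<^sub>L X"
    and X': "X' = a *\<^sub>R X + b *\<^sub>R Y" and Y': "Y' = c *\<^sub>R X + d *\<^sub>R Y"
  shows "op_power X' i o\<^sub>L op_power Y' l \<in> span (monomials X Y (i + l))"
proof -
  have step: "(s *\<^sub>R X + t *\<^sub>R Y) o\<^sub>L Z \<in> span (monomials X Y (Suc n))"
    if "Z \<in> span (monomials X Y n)" for s t Z n
    using compose_in_span_monomials[OF comm that]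
    by (simp add: bounded_bilinear.add_left[OF bounded_bilinear_blinfun_compose] bounded_bilinear.scaleR_left[OF bounded_bilinear_blinfun_compose] span_add span_scale)
  have Y'_power: "op_power Y' l \<in> span (monomials X Y l)"
  proof (induction l)
    case 0
    have "id_blinfun \<in> monomials X Y 0"
      unfolding monomials_def by (auto intro!: exI blinfun_eqI)
    then show ?case by (simp add: span_base)
  next
    case (Suc l)
    then show ?case using step by (simp add: Y')
  qed
  show ?thesis
  proof (induction i)
    case 0
    have "op_power X' 0 o\<^sub>L op_power Y' l = op_power Y' l" by (intro blinfun_eqI) simp
    then show ?case using Y'_power by simp
  next
    case (Suc i)
    have "op_power X' (Suc i) o\<^sub>L op_power Y' l = X' o\<^sub>L (op_power X' i o\<^sub>L op_power Y' l)"
      by (intro blinfun_eqI) simp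
    then show ?case using step[OF Suc] by (simp add: X')
  qed
qed

text \<open>The properties of a nonnegative quadratic form by which it can be estimated along linear
  combinations of operators. The subadditivity with factor \<open>2\<close> is the parallelogram law
  without the term \<open>\<phi> (x - y)\<close>.\<close>

locale nonneg_quadratic_form =
  fixes \<phi> :: "'a::real_normed_vector \<Rightarrow> real"
  assumes nonneg: "0 \<le> \<phi> x"
    and add_le: "\<phi> (x + y) \<le> 2 * \<phi> x + 2 * \<phi> y"
    and scaleR: "\<phi> (r *\<^sub>R x) = r\<^sup>2 * \<phi> x"
begin

lemma span_bound:
  assumes S: "\<And>W z. W \<in> S \<Longrightarrow> \<phi> (blinfun_apply W z) \<le> N z"
    and Z: "Z \<in> span S" and N: "\<And>z. 0 \<le> N z"
  shows "\<exists>C\<ge>0. \<forall>z. \<phi> (blinfun_apply Z z) \<le> C * N z"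
  using Z
proof (induction rule: span_induct_alt)
  case base
  have "\<phi> 0 = 0" using scaleR[of 0 0] by simp
  then show ?case by (intro exI[of _ 0]) simp
next
  case (step c W Y)
  then obtain C where C: "C \<ge> 0" "\<And>z. \<phi> (Y z) \<le> C * N z" by blast
  have "\<phi> ((c *\<^sub>R W + Y) z) \<le> (2 * c\<^sup>2 + 2 * C) * N z" for z
  proof -
    have "c\<^sup>2 * \<phi> (W z) \<le> c\<^sup>2 * N z" by (intro mult_left_mono S step) simp
    then show ?thesis
      using add_le[of "c *\<^sub>R W z" "Y z"] C(2)[of z]
      by (simp add: blinfun.bilinear_simps scaleR algebra_simps)
  qed
  then show ?case using C(1) by (intro exI[of _ "2 * c\<^sup>2 + 2 * C"]) auto
qed

text \<open>Every monomial in the new variables is a combination of monomials of the same degree in the old ones,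
  so summing the form over the old monomials controls it on the new ones. Applied in both directions of
  an invertible substitution, this makes the two sums equivalent.\<close>

lemma change_of_variables_bound:
  assumes "X o\<^sub>L Y = Y o\<^sub>L X"
    and "X' = a *\<^sub>R X + b *\<^sub>R Y" and "Y' = c *\<^sub>R X + d *\<^sub>R Y"
  shows "\<exists>C\<ge>0. \<forall>z. (\<Sum>j=0..m. \<phi> (op_power X' j (op_power Y' (m - j) z)))
      \<le> C * (\<Sum>j=0..m. \<phi> (op_power X j (op_power Y (m - j) z)))"
proof -
  define N where "N z = (\<Sum>j=0..m. \<phi> (op_power X j (op_power Y (m - j) z)))" for z
  have N_nonneg: "0 \<le> N z" for z unfolding N_def by (intro sum_nonneg nonneg)
  have mono_le: "\<phi> (W z) \<le> N z" if W: "W \<in> monomials X Y m" for W z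
  proof -
    obtain i l where il: "W = op_power X i o\<^sub>L op_power Y l" "i + l = m"
      using W unfolding monomials_def by blast
    then have "l = m - i" "i \<in> {0..m}" by auto
    then show ?thesis
      unfolding N_def il(1)
      using member_le_sum[of i "{0..m}" "\<lambda>j. \<phi> (op_power X j (op_power Y (m - j) z))"] nonneg
      by simp
  qed
  have "\<exists>C\<ge>0. \<forall>z. \<phi> ((op_power X' j o\<^sub>L op_power Y' (m - j)) z) \<le> C * N z" if "j \<in> {0..m}" for j
    using span_bound[OF mono_le monomials_change_of_variables[OF assms, of j "m - j"] N_nonneg] that
    by simp
  then obtain C where C: "\<And>j. j \<in> {0..m} \<Longrightarrow> C j \<ge> 0"
    "\<And>j z. j \<in> {0..m} \<Longrightarrow> \<phi> ((op_power X' j o\<^sub>L op_power Y' (m - j)) z) \<le> C j * N z"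
    by metis
  have "(\<Sum>j=0..m. \<phi> (op_power X' j (op_power Y' (m - j) z))) \<le> sum C {0..m} * N z" for z
    unfolding sum_distrib_right using C(2) by (intro sum_mono) simp
  moreover have "sum C {0..m} \<ge> 0" using C(1) by (rule sum_nonneg)
  ultimately show ?thesis unfolding N_def by blast
qed

end
section \<open>Adjoints on complex Hilbert spaces\<close>

text \<open>The representing vector is the minimizer of \<open>J y = (norm y)\<^sup>2 / 2 - f y\<close>, whose stationarity condition
  is the claim. By the parallelogram law \<open>J\<close> is uniformly convex, so minimizing sequences are Cauchy.\<close>

lemma riesz_representation:
  fixes f :: "'a::{real_inner,banach} \<Rightarrow> real"
  assumes "bounded_linear f"
  shows "\<exists>w. \<forall>x. f x = inner x w"
proof -
  interpret f: bounded_linear f by fact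
  obtain K where K: "\<And>x. norm (f x) \<le> norm x * K" using f.bounded by blast
  define J where "J y = (norm y)\<^sup>2 / 2 - f y" for y
  have J_low: "- (K\<^sup>2 / 2) \<le> J y" for y
  proof -
    have "f y \<le> norm y * K" using K[of y] by simp
    moreover have "0 \<le> (norm y - K)\<^sup>2" by simp
    ultimately show ?thesis unfolding J_def by (simp add: power2_diff)
  qed
  define m where "m = Inf (range J)"
  have bdd: "bdd_below (range J)" using J_low unfolding bdd_below_def by blast
  have m_le: "m \<le> J y" for y unfolding m_def using bdd by (simp add: cInf_lower)
  have "\<exists>y. J y < m + 1 / Suc n" for n
  proof -
    have "Inf (range J) < m + 1 / Suc n" unfolding m_def by simp
    from cInf_lessD[OF _ this] show ?thesis by blast
  qed
  then obtain y where y: "\<And>n. J (y n) < m + 1 / Suc n" by metis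
  have para: "(norm (u - v))\<^sup>2 / 4 = J u + J v - 2 * J ((1/2) *\<^sub>R (u + v))" for u v
    unfolding J_def power2_norm_eq_inner
    by (simp add: f.add f.scaleR inner_add inner_diff inner_commute field_simps)
  have "Cauchy y"
  proof (rule CauchyI)
    fix e :: real assume e: "e > 0"
    obtain N where N: "1 / Suc N < e\<^sup>2 / 8"
      using e nat_approx_posE[of "e\<^sup>2/8"] by auto
    have "norm (y i - y j) < e" if "i \<ge> N" "j \<ge> N" for i j
    proof -
      have small: "1 / Suc k \<le> 1 / Suc N" if "k \<ge> N" for k
        using that by (intro divide_left_mono) auto
      have "(norm (y i - y j))\<^sup>2 / 4 < 1 / Suc i + 1 / Suc j"
        using para[of "y i" "y j"] y[of i] y[of j] m_le[of "(1/2) *\<^sub>R (y i + y j)"] by linarith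
      also have "\<dots> < e\<^sup>2 / 4" using small[OF that(1)] small[OF that(2)] N by linarith
      finally have "(norm (y i - y j))\<^sup>2 < e\<^sup>2" by simp
      then show ?thesis using e by (meson less_imp_le power_less_imp_less_base)
    qed
    then show "\<exists>M. \<forall>m\<ge>M. \<forall>n\<ge>M. norm (y m - y n) < e" by blast
  qed
  then obtain w where w: "y \<longlonglongrightarrow> w" using Cauchy_convergent convergent_def by blast
  have "(\<lambda>n. J (y n)) \<longlonglongrightarrow> J w" unfolding J_def by (intro tendsto_intros w f.tendsto) simp
  moreover have "(\<lambda>n. m + 1 / Suc n) \<longlonglongrightarrow> m"
    using LIMSEQ_inverse_real_of_nat_add[of m] by (simp only: divide_inverse mult_1)
  moreover have "\<exists>N. \<forall>n\<ge>N. J (y n) \<le> m + 1 / Suc n" using y less_imp_le by blast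
  ultimately have "J w \<le> m" by (rule LIMSEQ_le)
  then have min: "J w \<le> J z" for z using m_le order_trans by blast
  have "f x = inner x w" for x
  proof (cases "x = 0")
    case False
    define a where "a = inner x w - f x"
    \<comment> \<open>The minimum of \<open>J\<close> on the line through \<open>w\<close> in direction \<open>x\<close>; \<open>a\<close> is the slope at \<open>w\<close>.\<close>
    define t where "t = - a / (norm x)\<^sup>2"
    have "J (w + t *\<^sub>R x) - J w = t * a + t\<^sup>2 * (norm x)\<^sup>2 / 2"
      unfolding J_def a_def power2_norm_eq_inner
      by (simp add: f.add f.scaleR inner_add inner_commute field_simps power2_eq_square)
    also have "\<dots> = - (a\<^sup>2 / (2 * (norm x)\<^sup>2))"
      using False by (simp add: t_def field_simps power2_eq_square)
    finally have "a\<^sup>2 / (2 * (norm x)\<^sup>2) \<le> 0" using min[of "w + t *\<^sub>R x"] by linarith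
    then have "a = 0" using False by (simp add: divide_le_0_iff)
    then show ?thesis by (simp add: a_def)
  qed simp
  then show ?thesis by blast
qed

text \<open>Representing \<open>\<lambda>x. inner (A x) y\<close> gives the adjoint for the real inner product. The imaginary part of
  the sesquilinear form is the real one with \<open>\<i> *\<^sub>C x\<close> in place of \<open>x\<close>, up to sign, so for complex-linear
  \<open>A\<close> this is the adjoint for \<open>cinner\<close> as well.\<close>

lemma adjoint_exists:
  assumes "complex_linear A"
  shows "\<exists>B. \<forall>x y. cinner (blinfun_apply A x) y = cinner x (blinfun_apply B y)"
proof -
  have "\<exists>w. \<forall>x. inner (A x) y = inner x w" for y
    by (intro riesz_representation bounded_linear_intros)
  then obtain g where g: "\<And>x y. inner (A x) y = inner x (g y)" by metis
  have eqI: "u = v" if "\<And>x. inner x u = inner x v" for u v :: 'a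
    using that[of "u - v"] by (metis inner_diff_right inner_eq_zero_iff right_minus_eq)
  have "bounded_linear g"
  proof (rule bounded_linear_intro)
    show "g (x + y) = g x + g y" for x y
      by (rule eqI) (simp add: g[symmetric] inner_add_right)
    show "g (r *\<^sub>R x) = r *\<^sub>R g x" for r x
      by (rule eqI) (simp add: g[symmetric])
    show "norm (g y) \<le> norm y * norm A" for y
    proof (cases "g y = 0")
      case False
      have "(norm (g y))\<^sup>2 = inner (A (g y)) y" by (simp add: g power2_norm_eq_inner)
      also have "\<dots> \<le> norm (A (g y)) * norm y" by (rule norm_cauchy_schwarz)
      also have "\<dots> \<le> (norm A * norm (g y)) * norm y"
        by (intro mult_right_mono norm_blinfun) simp
      finally show ?thesis using False by (simp add: power2_eq_square mult.commute mult.left_commute)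
    qed simp
  qed
  then obtain B where B: "\<And>y. blinfun_apply B y = g y"
    by (metis bounded_linear_Blinfun_apply)
  have Im: "Im (cinner x y) = - inner (\<i> *\<^sub>C x) y" for x y :: 'a
    by (simp add: Re_cinner[symmetric] cinner_scaleC_left)
  have "cinner (A x) y = cinner x (B y)" for x y
  proof (rule complex_eqI)
    show "Re (cinner (A x) y) = Re (cinner x (B y))" by (simp add: Re_cinner B g)
    have "\<i> *\<^sub>C A x = A (\<i> *\<^sub>C x)" using assms by (simp add: complex_linear_def)
    then show "Im (cinner (A x) y) = Im (cinner x (B y))" by (simp add: Im B g)
  qed
  then show ?thesis by blast
qed

lemma cinner_op_adjoint:
  assumes "complex_linear A"
  shows "cinner (blinfun_apply A x) y = cinner x (blinfun_apply (op_adjoint A) y)"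
proof -
  have "\<exists>!B. \<forall>x y. cinner (blinfun_apply A x) y = cinner x (blinfun_apply B y)"
  proof (rule ex_ex1I[OF adjoint_exists[OF assms]])
    fix B C assume B: "\<forall>x y. cinner (A x) y = cinner x (blinfun_apply B y)"
      and C: "\<forall>x y. cinner (A x) y = cinner x (blinfun_apply C y)"
    then have "inner x (B y) = inner x (C y)" for x y by (metis Re_cinner)
    then have "B y - C y = 0" for y
      by (metis inner_diff_right inner_eq_zero_iff right_minus_eq)
    then show "B = C" by (intro blinfun_eqI) simp
  qed
  from theI'[OF this] show ?thesis unfolding op_adjoint_def by blast
qed

lemma cinner_op_adjoint':
  assumes "complex_linear A"
  shows "cinner (blinfun_apply (op_adjoint A) x) y = cinner x (blinfun_apply A y)"
proof -
  have "cinner (op_adjoint A x) y = cnj (cinner y (op_adjoint A x))" by (rule cinner_commute)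
  also have "\<dots> = cnj (cinner (A y) x)" by (simp only: cinner_op_adjoint[OF assms])
  also have "\<dots> = cinner x (A y)" by (rule cinner_commute[symmetric])
  finally show ?thesis .
qed

lemma cinner_op_power_adjoint:
  assumes "complex_linear A"
  shows "cinner (blinfun_apply (op_power (op_adjoint A) j) x) y = cinner x (blinfun_apply (op_power A j) y)"
proof (induction j arbitrary: y)
  case (Suc j)
  have "cinner (op_power (op_adjoint A) (Suc j) x) y = cinner (op_power (op_adjoint A) j x) (A y)"
    by (simp add: cinner_op_adjoint'[OF assms])
  also have "\<dots> = cinner x (op_power A j (A y))" by (rule Suc)
  finally show ?case by (simp add: op_power_funpow funpow_swap1)
qed simp

section \<open>The indices as coercivity of real quadratic forms\<close>

lemma cinner_zero_left [simp]: "cinner 0 (y::'a::complex_hilbert_space) = 0"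
  using cinner_add_left[of 0 0 y] by simp

lemma cinner_scaleR_left: "cinner (r *\<^sub>R x) (y::'a::complex_hilbert_space) = of_real r * cinner x y"
  by (metis cinner_scaleC_left scaleC_of_real)

lemma cinner_diff_left: "cinner (x - y) (z::'a::complex_hilbert_space) = cinner x z - cinner y z"
  using cinner_add_left[of "x - y" y z] by simp

lemma cinner_sum_left:
  "cinner (\<Sum>i\<in>I. f i) (y::'a::complex_hilbert_space) = (\<Sum>i\<in>I. cinner (f i) y)"
  by (induction I rule: infinite_finite_induct) (auto simp: cinner_add_left)

lemma of_real_nonneg_Reals_iff: "complex_of_real r \<in> \<real>\<^sub>\<ge>\<^sub>0 \<longleftrightarrow> 0 \<le> r"
  by (simp add: complex_nonneg_Reals_iff)

lemma cinner_hermitian_part: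
  assumes "complex_linear B"
  shows "cinner (blinfun_apply (hermitian_part B) x) x = complex_of_real (inner (blinfun_apply B x) x)"
proof -
  have "cinner (op_adjoint B x) x = cnj (cinner (B x) x)"
    unfolding cinner_op_adjoint'[OF assms] by (rule cinner_commute)
  then have "cinner (hermitian_part B x) x = (1/2) * (cinner (B x) x + cnj (cinner (B x) x))"
    by (simp add: hermitian_part_def blinfun.bilinear_simps scaleR_right_distrib
        cinner_add_left cinner_scaleR_left)
  then show ?thesis by (simp add: complex_add_cnj Re_cinner)
qed

lemma op_le_0_hermitian_part_iff:
  assumes "complex_linear B"
  shows "op_le 0 (hermitian_part B) \<longleftrightarrow> (\<forall>x. 0 \<le> inner (blinfun_apply B x) x)"
  by (simp add: op_le_def cinner_hermitian_part[OF assms] of_real_nonneg_Reals_iff)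

text \<open>Moving the powers of the adjoint to the other side of the inner product turns both defining operator
  inequalities into inequalities between real quadratic forms, in which no adjoint occurs.\<close>

lemma op_le_sum_conjugates_iff:
  assumes A: "complex_linear A"
    and G: "\<And>x. cinner (blinfun_apply G x) x = complex_of_real (g x)"
  shows "op_le (\<kappa> *\<^sub>R id_blinfun) (\<Sum>j=0..m. op_power (op_adjoint A) j o\<^sub>L G o\<^sub>L op_power A j)
    \<longleftrightarrow> (\<forall>x. \<kappa> * (norm x)\<^sup>2 \<le> (\<Sum>j=0..m. g (blinfun_apply (op_power A j) x)))"
proof -
  have "cinner (((\<Sum>j=0..m. op_power (op_adjoint A) j o\<^sub>L G o\<^sub>L op_power A j) - \<kappa> *\<^sub>R id_blinfun) x) x
      = complex_of_real ((\<Sum>j=0..m. g (op_power A j x)) - \<kappa> * (norm x)\<^sup>2)" for x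
    by (simp add: blinfun.bilinear_simps blinfun.sum_left cinner_diff_left cinner_sum_left
        cinner_scaleR_left cinner_op_power_adjoint[OF A] G cinner_self)
  then show ?thesis
    unfolding op_le_def by (simp only: of_real_nonneg_Reals_iff diff_ge_0_iff_ge)
qed

lemma hypocoercive_upto_iff:
  assumes "complex_linear B"
  shows "hypocoercive_upto B m \<longleftrightarrow>
    coercive_form (\<lambda>x. \<Sum>j=0..m. inner (blinfun_apply B (op_power B j x)) (op_power B j x))"
  unfolding hypocoercive_upto_def coercive_form_def
  by (simp only: op_le_sum_conjugates_iff[OF assms cinner_hermitian_part[OF assms]])

lemma hypocontractive_upto_iff:
  assumes "complex_linear D"
  shows "hypocontractive_upto D m \<longleftrightarrow>
    coercive_form (\<lambda>x. \<Sum>j=0..m. (norm (op_power D j x))\<^sup>2 - (norm (op_power D (Suc j) x))\<^sup>2)"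
proof -
  have defect: "cinner ((id_blinfun - (op_adjoint D o\<^sub>L D)) x) x
      = complex_of_real ((norm x)\<^sup>2 - (norm (D x))\<^sup>2)" for x
    by (simp add: blinfun.bilinear_simps cinner_diff_left cinner_op_adjoint'[OF assms] cinner_self)
  show ?thesis
    unfolding hypocontractive_upto_def coercive_form_def
    by (simp add: op_le_sum_conjugates_iff[OF assms defect])
qed

section \<open>Exponential stability\<close>

text \<open>Since \<open>D\<close> is a contraction, only complete blocks of \<open>n\<close> steps have to be counted, each of which gains
  the factor \<open>r\<close>. The incomplete block costs the constant \<open>1 / r\<close>.\<close>

lemma exp_stable_discrete_if_power_contracts:
  assumes n: "n > 0" and contr: "\<And>x. norm (blinfun_apply D x) \<le> norm x"
    and r: "0 < r" "r < 1"
    and power: "\<And>x. norm (blinfun_apply (op_power D n) x) \<le> r * norm x"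
  shows "exp_stable_discrete D"
proof -
  define q where "q = root n r"
  have q: "0 < q" "q < 1" "q ^ n = r" using n r by (auto simp: q_def)
  have contr_pow: "norm ((blinfun_apply D ^^ s) x) \<le> norm x" for s x
    by (induction s) (auto intro: order_trans[OF contr])
  have block: "norm ((blinfun_apply (op_power D n) ^^ i) x) \<le> r ^ i * norm x" for i x
  proof (induction i)
    case (Suc i)
    have "norm ((blinfun_apply (op_power D n) ^^ Suc i) x)
        \<le> r * norm ((blinfun_apply (op_power D n) ^^ i) x)"
      using power by simp
    also have "\<dots> \<le> r * (r ^ i * norm x)" by (intro mult_left_mono Suc) (use r in simp)
    finally show ?case by (simp add: mult.assoc)
  qed simp
  have "norm (op_power D k x) \<le> 1 / r * q ^ k * norm x" for k x
  proof -
    define i where "i = k div n"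
    define s where "s = k mod n"
    have k: "k = s + n * i" and s: "s \<le> n"
      using n by (auto simp: i_def s_def intro: less_imp_le)
    have "op_power D k x = (blinfun_apply D ^^ s) (((blinfun_apply D ^^ n) ^^ i) x)"
      unfolding k op_power_funpow by (simp add: funpow_add funpow_mult)
    then have "norm (op_power D k x) \<le> norm ((blinfun_apply (op_power D n) ^^ i) x)"
      using contr_pow by (simp add: op_power_funpow)
    also have "\<dots> \<le> r ^ i * norm x" by (rule block)
    also have "r ^ i \<le> 1 / r * q ^ k"
    proof -
      have "q ^ n \<le> q ^ s" using q s by (intro power_decreasing) auto
      then have "1 \<le> 1 / r * q ^ s" using r q by (simp add: pos_le_divide_eq)
      then have "r ^ i * 1 \<le> r ^ i * (1 / r * q ^ s)" using r by (intro mult_left_mono) auto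
      moreover have "q ^ (n * i) = r ^ i" by (simp only: power_mult q(3))
      ultimately show ?thesis by (simp add: k power_add ac_simps)
    qed
    finally show ?thesis by (simp add: mult_right_mono)
  qed
  then show ?thesis
    unfolding exp_stable_discrete_def using q r by (intro exI[of _ "1 / r"] conjI exI[of _ q]) auto
qed

text \<open>The Lyapunov function is \<open>p\<close>; along a trajectory \<open>y\<close> its derivative is at most
  \<open>- 2 * c * (norm (y s))\<^sup>2\<close>, and \<open>p\<close> is comparable with the squared norm.\<close>

lemma exp_stable_continuous_if_quadratic_Lyapunov:
  fixes A :: "'a::{real_inner,banach} \<Rightarrow>\<^sub>L 'a" and L :: "'i \<Rightarrow> 'a \<Rightarrow>\<^sub>L 'a" and I :: "'i set"
  defines "p \<equiv> \<lambda>x. \<Sum>k\<in>I. (norm (blinfun_apply (L k) x))\<^sup>2"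
  assumes below: "\<And>x. (norm x)\<^sup>2 \<le> p x"
    and c: "c > 0"
    and decay: "\<And>x. c * (norm x)\<^sup>2 \<le> - (\<Sum>k\<in>I. inner (blinfun_apply (L k) x) (blinfun_apply (L k) (blinfun_apply A x)))"
  shows "exp_stable_continuous A"
proof -
  define P where "P = (\<Sum>k\<in>I. (norm (L k))\<^sup>2) + 1"
  have P: "P \<ge> 1" unfolding P_def by (simp add: sum_nonneg)
  have above: "p x \<le> P * (norm x)\<^sup>2" for x
  proof -
    have "p x \<le> (\<Sum>k\<in>I. (norm (L k))\<^sup>2 * (norm x)\<^sup>2)"
      unfolding p_def power_mult_distrib[symmetric] by (intro sum_mono power_mono norm_blinfun) auto
    also have "\<dots> \<le> P * (norm x)\<^sup>2"
      unfolding P_def sum_distrib_right[symmetric] by (intro mult_right_mono) auto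
    finally show ?thesis .
  qed
  define w where "w = c / P"
  have w: "w > 0" using c P by (simp add: w_def)
  have "norm (op_exp (t *\<^sub>R A) x) \<le> sqrt P * exp (- w * t) * norm x" if t: "t \<ge> 0" for x t
  proof -
    define y where "y s = op_exp (s *\<^sub>R A) x" for s
    have y': "(y has_vector_derivative A (y s)) (at s)" for s
      unfolding y_def blinfun_apply_blinfun_compose[symmetric]
      by (rule bounded_linear.has_vector_derivative[OF
          blinfun.bounded_linear_left op_exp_has_vector_derivative])
    have Ly': "((\<lambda>s. L k (y s)) has_vector_derivative L k (A (y s))) (at s)" for k s
      using bounded_linear.has_vector_derivative[OF blinfun.bounded_linear_right y'] .
    have py': "((\<lambda>s. p (y s)) has_real_derivative (\<Sum>k\<in>I. 2 * inner (L k (y s)) (L k (A (y s))))) (at s)" for s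
      unfolding p_def power2_norm_eq_inner has_real_derivative_iff_has_vector_derivative
    proof (intro has_vector_derivative_sum)
      fix k
      show "((\<lambda>s. inner (L k (y s)) (L k (y s))) has_vector_derivative
          2 * inner (L k (y s)) (L k (A (y s)))) (at s)"
        using bounded_bilinear.has_vector_derivative[OF bounded_bilinear_inner Ly'[of k s] Ly'[of k s]]
        by (simp add: inner_commute)
    qed
    define g where "g s = exp (2 * w * s) * p (y s)" for s
    have "g t \<le> g 0"
    proof (rule DERIV_nonpos_imp_nonincreasing[OF t])
      fix s
      let ?d = "\<Sum>k\<in>I. 2 * inner (L k (y s)) (L k (A (y s)))"
      have "(g has_real_derivative exp (2 * w * s) * (2 * w * p (y s) + ?d)) (at s)"
        unfolding g_def by (auto intro!: derivative_eq_intros py' simp: algebra_simps)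
      moreover have "w * p (y s) \<le> c * (norm (y s))\<^sup>2"
        using mult_left_mono[OF above[of "y s"], of w] w P by (simp add: w_def)
      then have "2 * w * p (y s) + ?d \<le> 0"
        using decay[of "y s"] by (simp add: sum_distrib_left[symmetric])
      ultimately show "\<exists>d. (g has_real_derivative d) (at s) \<and> d \<le> 0"
        using mult_nonneg_nonpos[OF exp_ge_zero] by blast
    qed
    then have "exp (2 * w * t) * p (y t) \<le> P * (norm x)\<^sup>2"
      using above[of x] by (simp add: g_def y_def op_exp_0)
    then have "p (y t) \<le> exp (- (2 * w * t)) * (P * (norm x)\<^sup>2)"
      by (simp add: exp_minus field_simps)
    then have "(norm (y t))\<^sup>2 \<le> exp (- (2 * w * t)) * (P * (norm x)\<^sup>2)"
      using below order_trans by blast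
    also have "\<dots> = (sqrt P * exp (- w * t) * norm x)\<^sup>2"
      using P by (simp add: power_mult_distrib exp_double[symmetric])
    finally show ?thesis
      unfolding y_def using P by (intro power2_le_imp_le[of "norm _"]) auto
  qed
  then show ?thesis
    unfolding exp_stable_continuous_def using P w by (intro exI[of _ "sqrt P"] conjI exI[of _ w]) auto
qed

section \<open>Cayley pairs\<close>

text \<open>The algebraic relation between a generator \<open>B\<close> and its Cayley transform
  \<open>D = (I - h B) (I + h B)\<inverse>\<close> with \<open>h = \<tau> / 2\<close>, in a form that both directions of the
  transform produce.\<close>

locale cayley_pair =
  fixes h :: real and B D R :: "'a::{real_inner,banach} \<Rightarrow>\<^sub>L 'a"
  assumes h_pos: "h > 0"
    and RT: "R o\<^sub>L (id_blinfun + h *\<^sub>R B) = id_blinfun"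
    and TR: "(id_blinfun + h *\<^sub>R B) o\<^sub>L R = id_blinfun"
    and DT: "D o\<^sub>L (id_blinfun + h *\<^sub>R B) = id_blinfun - h *\<^sub>R B"
begin

abbreviation T where "T \<equiv> id_blinfun + h *\<^sub>R B"
abbreviation U where "U \<equiv> id_blinfun - h *\<^sub>R B"

lemma T_R [simp]: "T (R x) = x" and R_T [simp]: "R (T x) = x" and D_T: "D (T x) = U x"
  using arg_cong[OF TR, of "\<lambda>F. F x"] arg_cong[OF RT, of "\<lambda>F. F x"] arg_cong[OF DT, of "\<lambda>F. F x"]
  by simp_all

lemma TU_commute: "T o\<^sub>L U = U o\<^sub>L T"
  by (rule blinfun_eqI) (simp add: blinfun.bilinear_simps algebra_simps)

lemma D_T_commute: "D o\<^sub>L T = T o\<^sub>L D"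
proof (rule blinfun_eqI)
  fix x
  have "T (D (T (R x))) = T (U (R x))" by (simp only: D_T)
  also have "\<dots> = U (T (R x))"
    using arg_cong[OF TU_commute, of "\<lambda>F. F (R x)"] by simp
  finally show "(D o\<^sub>L T) x = (T o\<^sub>L D) x" by (simp only: T_R D_T blinfun_apply_blinfun_compose)
qed

text \<open>\<open>T x\<close> and \<open>U x = D (T x)\<close> differ only in the sign of \<open>h *\<^sub>R B x\<close>, so only the cross terms survive. Up to the
  factor \<open>4 * h\<close>, the energy lost in one discrete step from \<open>T x\<close> is the dissipation rate of the flow
  at \<open>x\<close>; everything that relates the two indices rests on this.\<close>

lemma energy_identity:
  "(norm (T x))\<^sup>2 - (norm (D (T x)))\<^sup>2 = 4 * h * inner (B x) x"
  unfolding D_T power2_norm_eq_inner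
  by (simp add: blinfun.bilinear_simps inner_add inner_diff inner_commute)

lemma contractive_iff_dissipative:
  "norm D \<le> 1 \<longleftrightarrow> (\<forall>x. 0 \<le> inner (B x) x)"
proof -
  have "norm D \<le> 1 \<longleftrightarrow> (\<forall>x. norm (D x) \<le> norm x)"
  proof
    show "\<forall>x. norm (D x) \<le> norm x" if "norm D \<le> 1"
    proof
      show "norm (D x) \<le> norm x" for x
        using norm_blinfun[of D x] mult_right_mono[OF that norm_ge_zero[of x]] by simp
    qed
    show "norm D \<le> 1" if "\<forall>x. norm (D x) \<le> norm x"
      using that by (intro norm_blinfun_bound) simp_all
  qed
  also have "\<dots> \<longleftrightarrow> (\<forall>x. norm (D (T x)) \<le> norm (T x))" by (metis T_R)
  also have "\<dots> \<longleftrightarrow> (\<forall>x. 0 \<le> inner (B x) x)"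
  proof (intro all_cong1)
    fix x
    have pos: "0 \<le> 4 * h * inner (B x) x \<longleftrightarrow> 0 \<le> inner (B x) x"
      using h_pos by (simp add: zero_le_mult_iff)
    have "norm (D (T x)) \<le> norm (T x) \<longleftrightarrow> (norm (D (T x)))\<^sup>2 \<le> (norm (T x))\<^sup>2"
      by (simp add: abs_le_square_iff[symmetric])
    also have "\<dots> \<longleftrightarrow> 0 \<le> inner (B x) x"
      using energy_identity[of x] pos by linarith
    finally show "norm (D (T x)) \<le> norm (T x) \<longleftrightarrow> 0 \<le> inner (B x) x" .
  qed
  finally show ?thesis .
qed

lemma nonneg_quadratic_form_B:
  assumes "\<And>x. 0 \<le> inner (B x) x"
  shows "nonneg_quadratic_form (\<lambda>x. inner (B x) x)"
proof
  show "0 \<le> inner (B x) x" for x by (rule assms)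
  show "inner (B (x + y)) (x + y) \<le> 2 * inner (B x) x + 2 * inner (B y) y" for x y
    using assms[of "x - y"] by (simp add: blinfun.bilinear_simps inner_add inner_diff)
  show "inner (B (r *\<^sub>R x)) (r *\<^sub>R x) = r\<^sup>2 * inner (B x) x" for r x
    by (simp add: blinfun.bilinear_simps power2_eq_square)
qed

text \<open>Evaluating at \<open>op_power T m x\<close> clears the denominators of all \<open>op_power D j\<close> with \<open>j \<le> m\<close>.\<close>

lemma D_power_T_power:
  assumes "j \<le> m"
  shows "op_power D j (op_power T m x) = op_power U j (op_power T (m - j) x)"
proof -
  have "op_power T m x = op_power T j (op_power T (m - j) x)"
    using assms by (simp add: op_power_funpow flip: funpow_add[THEN fun_cong, unfolded comp_apply])
  moreover have "op_power D j (op_power T j z) = op_power U j z" for z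
    using arg_cong[OF op_power_mult_commuting[OF D_T_commute, of j], of "\<lambda>F. F z"] by (simp add: DT)
  ultimately show ?thesis by simp
qed

lemma power_inverse:
  "op_power R m o\<^sub>L op_power T m = id_blinfun" "op_power T m o\<^sub>L op_power R m = id_blinfun"
proof -
  have comm: "R o\<^sub>L T = T o\<^sub>L R" using RT TR by simp
  show "op_power R m o\<^sub>L op_power T m = id_blinfun" "op_power T m o\<^sub>L op_power R m = id_blinfun"
    using op_power_mult_commuting[OF comm, of m] op_power_mult_commuting[OF comm[symmetric], of m]
    by (simp_all add: RT TR op_power_id)
qed

text \<open>Each of three steps preserves coercivity. Evaluating the left form at \<open>T x\<close> yields \<open>4 * h\<close> times the dissipation of
  \<open>B\<close> along \<open>op_power D j x\<close>. Evaluating that at \<open>op_power T m x\<close> replaces these vectors by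
  \<open>op_power U j (op_power T (m - j) x)\<close>. These come from the monomials of degree \<open>m\<close> in \<open>U\<close>
  and \<open>T\<close>, which are related to \<open>B\<close> and the identity by an invertible linear substitution, so they may
  be replaced by the powers of \<open>B\<close>.\<close>

lemma coercive_forms_iff:
  assumes diss: "\<And>x. 0 \<le> inner (B x) x"
  shows "coercive_form (\<lambda>x. \<Sum>j=0..m. (norm (op_power D j x))\<^sup>2 - (norm (op_power D (Suc j) x))\<^sup>2)
    \<longleftrightarrow> coercive_form (\<lambda>x. \<Sum>j=0..m. inner (B (op_power B j x)) (op_power B j x))"
proof -
  interpret nonneg_quadratic_form "\<lambda>x. inner (B x) x"
    by (rule nonneg_quadratic_form_B[OF diss])
  define \<phi> where "\<phi> x = inner (B x) x" for x
  have \<phi>_nonneg: "0 \<le> \<phi> x" for x using diss by (simp add: \<phi>_def)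
  have D_T_power: "op_power D j (T x) = T (op_power D j x)" for j x
    using arg_cong[OF op_power_commute[OF D_T_commute[symmetric], of j], of "\<lambda>F. F x"] by simp
  have defect: "(\<Sum>j=0..m. (norm (op_power D j (T x)))\<^sup>2 - (norm (op_power D (Suc j) (T x)))\<^sup>2)
      = 4 * h * (\<Sum>j=0..m. \<phi> (op_power D j x))" for x
    unfolding sum_distrib_left
  proof (rule sum.cong[OF refl])
    show "(norm (op_power D j (T x)))\<^sup>2 - (norm (op_power D (Suc j) (T x)))\<^sup>2
        = 4 * h * \<phi> (op_power D j x)" for j
      using energy_identity[of "op_power D j x"]
      by (simp only: op_power.simps blinfun_apply_blinfun_compose D_T_power \<phi>_def)
  qed
  have scale: "coercive_form (\<lambda>x. 4 * h * p x) \<longleftrightarrow> coercive_form p" if "\<And>x. 0 \<le> p x" for p :: "'a \<Rightarrow> real"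
    using coercive_form_dominated[of "\<lambda>x. 4 * h * p x" "4 * h" p]
      coercive_form_dominated[of p "1 / (4 * h)" "\<lambda>x. 4 * h * p x"] h_pos that by auto
  have "coercive_form (\<lambda>x. \<Sum>j=0..m. (norm (op_power D j x))\<^sup>2 - (norm (op_power D (Suc j) x))\<^sup>2)
      \<longleftrightarrow> coercive_form (\<lambda>x. 4 * h * (\<Sum>j=0..m. \<phi> (op_power D j x)))"
    unfolding defect[symmetric]
    by (rule coercive_form_compose_iff[OF RT TR, symmetric])
  also have "\<dots> \<longleftrightarrow> coercive_form (\<lambda>x. \<Sum>j=0..m. \<phi> (op_power D j x))"
    by (rule scale) (intro sum_nonneg \<phi>_nonneg)
  also have "\<dots> \<longleftrightarrow> coercive_form (\<lambda>x. \<Sum>j=0..m. \<phi> (op_power D j (op_power T m x)))"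
    by (rule coercive_form_compose_iff[OF power_inverse[of m], symmetric])
  also have "\<dots> \<longleftrightarrow> coercive_form (\<lambda>x. \<Sum>j=0..m. \<phi> (op_power U j (op_power T (m - j) x)))"
    by (simp add: D_power_T_power)
  also have "\<dots> \<longleftrightarrow> coercive_form (\<lambda>x. \<Sum>j=0..m. \<phi> (op_power B j x))"
  proof -
    define \<psi> where "\<psi> X Y x = (\<Sum>j=0..m. \<phi> (op_power X j (op_power Y (m - j) x)))"
      for X Y :: "'a \<Rightarrow>\<^sub>L 'a" and x
    have \<psi>_nonneg: "0 \<le> \<psi> X Y x" for X Y x unfolding \<psi>_def by (intro sum_nonneg \<phi>_nonneg)
    have \<psi>_B: "\<psi> B id_blinfun = (\<lambda>x. \<Sum>j=0..m. \<phi> (op_power B j x))"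
      by (rule ext) (simp add: \<psi>_def op_power_id)
    have B_one: "B o\<^sub>L id_blinfun = id_blinfun o\<^sub>L B" by (rule blinfun_eqI) simp
    obtain C where C: "C \<ge> 0" "\<And>x. \<psi> U T x \<le> C * \<psi> B id_blinfun x"
      using change_of_variables_bound[OF B_one, of U "- h" 1 T h 1 m]
      unfolding \<psi>_def \<phi>_def by (auto simp: add.commute)
    have "B = (- (1 / (2 * h))) *\<^sub>R U + (1 / (2 * h)) *\<^sub>R T"
      using h_pos by (intro blinfun_eqI) (simp add: blinfun.bilinear_simps algebra_simps flip: scaleR_left_distrib)
    moreover have "id_blinfun = (1 / 2) *\<^sub>R U + (1 / 2) *\<^sub>R T"
      by (intro blinfun_eqI) (simp add: blinfun.bilinear_simps algebra_simps flip: scaleR_left_distrib)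
    ultimately obtain C' where C': "C' \<ge> 0" "\<And>x. \<psi> B id_blinfun x \<le> C' * \<psi> U T x"
      using change_of_variables_bound[OF TU_commute[symmetric], of B _ _ id_blinfun _ _ m]
      unfolding \<psi>_def \<phi>_def by meson
    have "coercive_form (\<psi> U T) \<longleftrightarrow> coercive_form (\<psi> B id_blinfun)"
      using coercive_form_dominated[where p = "\<psi> U T", OF _ C \<psi>_nonneg]
        coercive_form_dominated[where p = "\<psi> B id_blinfun", OF _ C' \<psi>_nonneg] by blast
    moreover have "\<psi> U T = (\<lambda>x. \<Sum>j=0..m. \<phi> (op_power U j (op_power T (m - j) x)))"
      by (rule ext) (simp only: \<psi>_def)
    ultimately show ?thesis by (simp only: \<psi>_B)
  qed
  finally show ?thesis unfolding \<phi>_def .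
qed

text \<open>For \<open>n\<close> so large that \<open>op_power D n\<close> halves norms, \<open>p x = (\<Sum>k<n. (norm (op_power D k x))\<^sup>2)\<close> is a
  Lyapunov function for \<open>D\<close>. It is one for the flow too: polarization gives
  \<open>p (T x) - p (U x) = 4 * h * (\<Sum>k<n. inner (op_power D k x) (op_power D k (B x)))\<close>, where the
  left side is \<open>p (T x) - p (D (T x))\<close> and telescopes.\<close>

lemma exp_stable_continuous_if_discrete:
  assumes "exp_stable_discrete D"
  shows "exp_stable_continuous (- B)"
proof -
  obtain C q where Cq: "C \<ge> 1" "0 < q" "q < 1"
    and bound: "\<And>x k. norm (op_power D k x) \<le> C * q ^ k * norm x"
    using assms unfolding exp_stable_discrete_def by blast
  obtain n0 where n0: "q ^ n0 < 1 / (2 * C)"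
    using real_arch_pow_inv[of "1 / (2 * C)" q] Cq by auto
  define n where "n = Suc n0"
  have Cn: "C * q ^ n \<le> 1 / 2"
  proof -
    have "q ^ n \<le> q ^ n0" using Cq by (intro power_decreasing) (auto simp: n_def)
    then have "q ^ n \<le> 1 / (2 * C)" using n0 by simp
    then show ?thesis using Cq(1) by (simp add: field_simps)
  qed
  have half: "norm (op_power D n x) \<le> 1 / 2 * norm x" for x
    using bound[of n x] mult_right_mono[OF Cn norm_ge_zero[of x]] by linarith
  define c where "c = 1 / (8 * h * (norm R + 1)\<^sup>2)"
  have nR: "norm R + 1 > 0" by (simp add: add_nonneg_pos)
  show ?thesis
  proof (rule exp_stable_continuous_if_quadratic_Lyapunov[where I = "{..<n}" and L = "op_power D" and c = c])
    show "c > 0" using h_pos nR by (simp add: c_def)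
    show "(norm x)\<^sup>2 \<le> (\<Sum>k<n. (norm (op_power D k x))\<^sup>2)" for x
      using member_le_sum[of 0 "{..<n}" "\<lambda>k. (norm (op_power D k x))\<^sup>2"] by (simp add: n_def)
    fix x
    have pol: "(norm (op_power D k (T x)))\<^sup>2 - (norm (op_power D (Suc k) (T x)))\<^sup>2
        = 4 * h * inner (op_power D k x) (op_power D k (B x))" for k
    proof -
      have "op_power D (Suc k) (T x) = op_power D k (U x)"
        by (simp only: op_power_Suc_right blinfun_apply_blinfun_compose D_T)
      then show ?thesis
        unfolding power2_norm_eq_inner
        by (simp add: blinfun.bilinear_simps inner_add inner_diff inner_commute)
    qed
    have "4 * h * (\<Sum>k<n. inner (op_power D k x) (op_power D k (B x)))
        = (norm (T x))\<^sup>2 - (norm (op_power D n (T x)))\<^sup>2"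
      unfolding sum_distrib_left pol[symmetric]
      using sum_lessThan_telescope'[of "\<lambda>k. (norm (op_power D k (T x)))\<^sup>2" n] by simp
    also have "\<dots> \<ge> (norm (T x))\<^sup>2 / 2"
    proof -
      have "(norm (op_power D n (T x)))\<^sup>2 \<le> (1 / 2 * norm (T x))\<^sup>2"
        by (intro power_mono half norm_ge_zero)
      also have "\<dots> = (norm (T x))\<^sup>2 / 4" by (simp add: power_mult_distrib power2_eq_square)
      finally show ?thesis using zero_le_power2[of "norm (T x)"] by linarith
    qed
    finally have T_le: "(norm (T x))\<^sup>2 / 2 \<le> 4 * h * (\<Sum>k<n. inner (op_power D k x) (op_power D k (B x)))" .
    have "norm x \<le> (norm R + 1) * norm (T x)"
    proof -
      have "norm (R (T x)) \<le> norm R * norm (T x)" by (rule norm_blinfun)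
      also have "\<dots> \<le> (norm R + 1) * norm (T x)" by (intro mult_right_mono) auto
      finally show ?thesis by (simp only: R_T)
    qed
    then have "(norm x)\<^sup>2 \<le> (norm R + 1)\<^sup>2 * (norm (T x))\<^sup>2"
      by (metis norm_ge_zero power_mono power_mult_distrib)
    then have "c * (norm x)\<^sup>2 \<le> (norm (T x))\<^sup>2 / (8 * h)"
      using h_pos nR by (simp add: c_def field_simps)
    also have "\<dots> \<le> (\<Sum>k<n. inner (op_power D k x) (op_power D k (B x)))"
      using T_le h_pos by (simp add: field_simps)
    finally show "c * (norm x)\<^sup>2 \<le> - (\<Sum>k<n. inner (op_power D k x) (op_power D k ((- B) x)))"
      by (simp add: blinfun.bilinear_simps sum_negf)
  qed
qed

end

text \<open>The sum in the definition of hypocontractivity telescopes to \<open>(norm x)\<^sup>2 - (norm (op_power D (Suc m) x))\<^sup>2\<close>,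
  so its coercivity says that \<open>op_power D (Suc m)\<close> is a strict contraction.\<close>

lemma hypocontractive_imp_exp_stable_discrete:
  assumes D: "complex_linear D" and contr: "norm D \<le> 1" and upto: "hypocontractive_upto D m"
  shows "exp_stable_discrete D"
proof -
  obtain \<kappa> where \<kappa>: "\<kappa> > 0" "\<And>x. \<kappa> * (norm x)\<^sup>2 \<le>
      (\<Sum>j=0..m. (norm (op_power D j x))\<^sup>2 - (norm (op_power D (Suc j) x))\<^sup>2)"
    using upto unfolding hypocontractive_upto_iff[OF D] coercive_form_def by blast
  \<comment> \<open>Capped below \<open>1\<close> so that \<open>sqrt (1 - \<mu>)\<close> is positive; \<open>\<kappa> = 1\<close> occurs if \<open>op_power D (Suc m) = 0\<close>.\<close>
  define \<mu> where "\<mu> = min \<kappa> (1 / 2)"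
  have \<mu>: "0 < \<mu>" "\<mu> < 1" "\<mu> \<le> \<kappa>" using \<kappa>(1) by (auto simp: \<mu>_def)
  have "norm (op_power D (Suc m) x) \<le> sqrt (1 - \<mu>) * norm x" for x
  proof (rule power2_le_imp_le)
    have "\<mu> * (norm x)\<^sup>2 \<le> \<kappa> * (norm x)\<^sup>2" using \<mu>(3) by (intro mult_right_mono) auto
    also have "\<dots> \<le> (\<Sum>j<Suc m. (norm (op_power D j x))\<^sup>2 - (norm (op_power D (Suc j) x))\<^sup>2)"
      using \<kappa>(2)[of x] by (simp add: atLeast0AtMost lessThan_Suc_atMost del: sum.lessThan_Suc)
    also have "\<dots> = (norm x)\<^sup>2 - (norm (op_power D (Suc m) x))\<^sup>2"
      using sum_lessThan_telescope'[of "\<lambda>k. (norm (op_power D k x))\<^sup>2" "Suc m"] by simp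
    finally show "(norm (op_power D (Suc m) x))\<^sup>2 \<le> (sqrt (1 - \<mu>) * norm x)\<^sup>2"
      using \<mu> by (simp add: power_mult_distrib algebra_simps)
  qed (use \<mu> in simp)
  moreover have "norm (D x) \<le> norm x" for x
    using norm_blinfun[of D x] mult_right_mono[OF contr norm_ge_zero[of x]] by simp
  ultimately show ?thesis
    using exp_stable_discrete_if_power_contracts[of "Suc m" D "sqrt (1 - \<mu>)"] \<mu> by simp
qed

lemma cayley_pair_index_iff:
  assumes "cayley_pair h B D R" "complex_linear B" "complex_linear D"
  shows "has_hypocontractivity_index D m \<longleftrightarrow> has_hypocoercivity_index B m"
proof -
  interpret cayley_pair h B D R by fact
  have "hypocontractive_upto D k \<longleftrightarrow> hypocoercive_upto B k" if "\<And>x. 0 \<le> inner (B x) x" for k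
    using coercive_forms_iff[OF that, of k]
    by (simp only: hypocontractive_upto_iff[OF assms(3)] hypocoercive_upto_iff[OF assms(2)])
  then show ?thesis
    unfolding has_hypocontractivity_index_def has_hypocoercivity_index_def
      op_le_0_hermitian_part_iff[OF assms(2)] contractive_iff_dissipative by blast
qed

section \<open>The Cayley transform and its inverse\<close>

lemma scalar_op_of_real: "scalar_op (complex_of_real r) = r *\<^sub>R id_blinfun"
proof (rule blinfun_eqI)
  show "scalar_op (complex_of_real r) x = (r *\<^sub>R id_blinfun) x" for x :: 'a
    unfolding scalar_op_def bounded_linear_Blinfun_apply[OF bounded_linear_scaleC]
    by (simp add: scaleC_of_real blinfun.bilinear_simps)
qed

lemma complex_linear_id: "complex_linear id_blinfun"
  by (simp add: complex_linear_def)

lemma complex_linear_add: "complex_linear A \<Longrightarrow> complex_linear B \<Longrightarrow> complex_linear (A + B)"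
  by (simp add: complex_linear_def blinfun.bilinear_simps scaleC_add_right)

lemma complex_linear_scaleR: "complex_linear A \<Longrightarrow> complex_linear (r *\<^sub>R A)"
  by (simp add: complex_linear_def blinfun.bilinear_simps
      linear_cmul[OF bounded_linear.linear[OF bounded_linear_scaleC]])

lemma complex_linear_minus: "complex_linear A \<Longrightarrow> complex_linear (- A)"
  using complex_linear_scaleR[of A "-1"] by simp

lemma complex_linear_diff: "complex_linear A \<Longrightarrow> complex_linear B \<Longrightarrow> complex_linear (A - B)"
  using complex_linear_add[OF _ complex_linear_minus, of A B] by simp

lemma complex_linear_compose: "complex_linear A \<Longrightarrow> complex_linear B \<Longrightarrow> complex_linear (A o\<^sub>L B)"
  by (simp add: complex_linear_def)

lemmas complex_linear_intros = complex_linear_id complex_linear_add complex_linear_scaleR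
  complex_linear_minus complex_linear_diff complex_linear_compose

lemma op_inverse_eq:
  assumes "is_op_inverse A S"
  shows "op_inverse A = S"
  unfolding op_inverse_def
proof (rule the_equality)
  show "is_op_inverse A S" by (rule assms)
  fix S' assume S': "is_op_inverse A S'"
  have "S' y = S y" for y
  proof -
    have "S' (A (S y)) = S y" "A (S y) = y"
      using S' assms unfolding is_op_inverse_def
      by (metis blinfun_apply_blinfun_compose blinfun_apply_id_blinfun)+
    then show ?thesis by simp
  qed
  then show "S' = S" by (rule blinfun_eqI)
qed

lemma is_op_inverse_scaleR:
  assumes "is_op_inverse A S" "r \<noteq> 0"
  shows "is_op_inverse (r *\<^sub>R A) ((1 / r) *\<^sub>R S)"
  using assms
  by (simp add: is_op_inverse_def complex_linear_scaleR
      bounded_bilinear.scaleR_left[OF bounded_bilinear_blinfun_compose]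
      bounded_bilinear.scaleR_right[OF bounded_bilinear_blinfun_compose])

lemma cayley_pair_cayley:
  assumes "h > 0" "is_op_inverse (id_blinfun + h *\<^sub>R B) R"
  shows "cayley_pair h B ((id_blinfun - h *\<^sub>R B) o\<^sub>L R) R"
proof
  show RT: "R o\<^sub>L (id_blinfun + h *\<^sub>R B) = id_blinfun"
    and "(id_blinfun + h *\<^sub>R B) o\<^sub>L R = id_blinfun"
    using assms(2) by (auto simp: is_op_inverse_def)
  show "((id_blinfun - h *\<^sub>R B) o\<^sub>L R) o\<^sub>L (id_blinfun + h *\<^sub>R B) = id_blinfun - h *\<^sub>R B"
    using arg_cong[OF RT, of "\<lambda>F. F x" for x] by (intro blinfun_eqI) simp
qed (rule assms(1))

text \<open>For the inverse transform, \<open>I + h B = 2 (D + I)\<inverse>\<close> and \<open>I - h B = 2 D (D + I)\<inverse>\<close>.\<close>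

lemma cayley_pair_inv_cayley:
  assumes "h > 0" "is_op_inverse (D + id_blinfun) S"
  shows "cayley_pair h ((- 1 / h) *\<^sub>R ((D - id_blinfun) o\<^sub>L S)) D ((1 / 2) *\<^sub>R (D + id_blinfun))"
proof -
  define B where "B = (- 1 / h) *\<^sub>R ((D - id_blinfun) o\<^sub>L S)"
  have SD: "S (D x) + S x = x" and DS: "D (S x) + S x = x" for x
    using assms(2) unfolding is_op_inverse_def
    by (metis blinfun.add_left blinfun.add_right blinfun_apply_blinfun_compose blinfun_apply_id_blinfun)+
  have hB: "h *\<^sub>R B x = S x - D (S x)" for x
    using assms(1) by (simp add: B_def blinfun.bilinear_simps)
  have T: "id_blinfun + h *\<^sub>R B = 2 *\<^sub>R S"
  proof (rule blinfun_eqI)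
    fix x
    have "x + h *\<^sub>R B x = (D (S x) + S x) + (S x - D (S x))" by (simp only: DS hB)
    then show "(id_blinfun + h *\<^sub>R B) x = (2 *\<^sub>R S) x"
      by (simp add: blinfun.bilinear_simps scaleR_2)
  qed
  have U: "id_blinfun - h *\<^sub>R B = 2 *\<^sub>R (D o\<^sub>L S)"
  proof (rule blinfun_eqI)
    fix x
    have "x - h *\<^sub>R B x = (D (S x) + S x) - (S x - D (S x))" by (simp only: DS hB)
    then show "(id_blinfun - h *\<^sub>R B) x = (2 *\<^sub>R (D o\<^sub>L S)) x"
      by (simp add: blinfun.bilinear_simps scaleR_2)
  qed
  have "cayley_pair h B D ((1 / 2) *\<^sub>R (D + id_blinfun))"
  proof
    show "(1 / 2) *\<^sub>R (D + id_blinfun) o\<^sub>L (id_blinfun + h *\<^sub>R B) = id_blinfun"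
      unfolding T by (rule blinfun_eqI) (simp add: blinfun.bilinear_simps DS flip: scaleR_right_distrib)
    show "(id_blinfun + h *\<^sub>R B) o\<^sub>L (1 / 2) *\<^sub>R (D + id_blinfun) = id_blinfun"
      unfolding T by (rule blinfun_eqI) (simp add: blinfun.bilinear_simps SD flip: scaleR_right_distrib)
    show "D o\<^sub>L (id_blinfun + h *\<^sub>R B) = id_blinfun - h *\<^sub>R B"
      unfolding T U by (rule blinfun_eqI) (simp add: blinfun.bilinear_simps)
  qed (rule assms(1))
  then show ?thesis by (simp add: B_def)
qed
theorem theorem4p14:
  fixes \<tau> :: real
  assumes "separable_space (euclidean :: 'a::complex_hilbert_space topology)"
    and "\<tau> > 0"
  shows "(\<forall>(Bc :: 'a \<Rightarrow>\<^sub>L 'a) m.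
            complex_linear Bc \<and> complex_of_real (2 / \<tau>) \<notin> op_spectrum (- Bc) \<and>
            exp_stable_continuous (- Bc) \<and> has_hypocoercivity_index Bc m \<longrightarrow>
            (let Bd = cayley \<tau> (- Bc)
             in exp_stable_discrete Bd \<and> has_hypocontractivity_index Bd m)) \<and>
         (\<forall>(Bd :: 'a \<Rightarrow>\<^sub>L 'a) m.
            complex_linear Bd \<and> - 1 \<notin> op_spectrum Bd \<and>
            exp_stable_discrete Bd \<and> has_hypocontractivity_index Bd m \<longrightarrow>
            (let Bc = - inv_cayley \<tau> Bd
             in exp_stable_continuous (- Bc) \<and> has_hypocoercivity_index Bc m))"
proof (intro conjI allI impI)
  have h: "\<tau> / 2 > 0" using assms(2) by simp
  fix Bc :: "'a \<Rightarrow>\<^sub>L 'a" and m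
  assume "complex_linear Bc \<and> complex_of_real (2 / \<tau>) \<notin> op_spectrum (- Bc) \<and>
    exp_stable_continuous (- Bc) \<and> has_hypocoercivity_index Bc m"
  then have Bc: "complex_linear Bc" and index: "has_hypocoercivity_index Bc m"
    and "complex_of_real (2 / \<tau>) \<notin> op_spectrum (- Bc)" by auto
  then have "\<exists>S. is_op_inverse (- Bc - scalar_op (complex_of_real (2 / \<tau>))) S"
    unfolding op_spectrum_def by blast
  then obtain S where "is_op_inverse (- Bc - (2 / \<tau>) *\<^sub>R id_blinfun) S"
    unfolding scalar_op_of_real by blast
  from is_op_inverse_scaleR[OF this, of "- (\<tau> / 2)"] h
  obtain R where R: "is_op_inverse ((- (\<tau> / 2)) *\<^sub>R (- Bc - (2 / \<tau>) *\<^sub>R id_blinfun)) R"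
    by auto
  have "(- (\<tau> / 2)) *\<^sub>R (- Bc - (2 / \<tau>) *\<^sub>R id_blinfun) = id_blinfun + (\<tau> / 2) *\<^sub>R Bc"
    using assms(2) by (simp add: scaleR_diff_right)
  with R have inv: "is_op_inverse (id_blinfun + (\<tau> / 2) *\<^sub>R Bc) R" by simp
  define Bd where "Bd = (id_blinfun - (\<tau> / 2) *\<^sub>R Bc) o\<^sub>L R"
  have cayley: "cayley \<tau> (- Bc) = Bd"
    by (simp add: cayley_def Bd_def op_inverse_eq[OF inv])
  have Bd: "complex_linear Bd"
    unfolding Bd_def using inv Bc by (intro complex_linear_intros) (auto simp: is_op_inverse_def)
  have Bd_index: "has_hypocontractivity_index Bd m"
    using cayley_pair_index_iff[OF cayley_pair_cayley[OF h inv] Bc] Bd index by (simp add: Bd_def)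
  then have "exp_stable_discrete Bd"
    using hypocontractive_imp_exp_stable_discrete[OF Bd]
    by (auto simp: has_hypocontractivity_index_def)
  with Bd_index show "let Bd = cayley \<tau> (- Bc)
      in exp_stable_discrete Bd \<and> has_hypocontractivity_index Bd m"
    by (simp add: cayley)
next
  have h: "\<tau> / 2 > 0" using assms(2) by simp
  fix Bd :: "'a \<Rightarrow>\<^sub>L 'a" and m
  assume "complex_linear Bd \<and> - 1 \<notin> op_spectrum Bd \<and>
    exp_stable_discrete Bd \<and> has_hypocontractivity_index Bd m"
  then have Bd: "complex_linear Bd" and stable: "exp_stable_discrete Bd"
    and index: "has_hypocontractivity_index Bd m" and spec: "- 1 \<notin> op_spectrum Bd" by auto
  have "scalar_op (- 1) = - (id_blinfun :: 'a \<Rightarrow>\<^sub>L 'a)"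
    using scalar_op_of_real[of "- 1"] by simp
  with spec obtain S where S: "is_op_inverse (Bd + id_blinfun) S"
    unfolding op_spectrum_def by auto
  define Bc where "Bc = (- 1 / (\<tau> / 2)) *\<^sub>R ((Bd - id_blinfun) o\<^sub>L S)"
  have inv_cayley: "- inv_cayley \<tau> Bd = Bc"
    by (simp add: inv_cayley_def Bc_def op_inverse_eq[OF S])
  have Bc: "complex_linear Bc"
    unfolding Bc_def using S Bd by (intro complex_linear_intros) (auto simp: is_op_inverse_def)
  have pair: "cayley_pair (\<tau> / 2) Bc Bd ((1 / 2) *\<^sub>R (Bd + id_blinfun))"
    unfolding Bc_def by (rule cayley_pair_inv_cayley[OF h S])
  show "let Bc = - inv_cayley \<tau> Bd
      in exp_stable_continuous (- Bc) \<and> has_hypocoercivity_index Bc m"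
    using cayley_pair.exp_stable_continuous_if_discrete[OF pair stable]
      cayley_pair_index_iff[OF pair Bc Bd] index
    by (simp add: inv_cayley)
qed

end
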